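(* Let $X=(X_n)_{n\in\mathbb{Z}}$ be a discrete white noise, i.e. a sequence of independent and identically distributed real random variables, and let $p>0$. Then $$X\in \ell_{\infty,-1/p}(\mathbb{Z}) \text{ almost surely} \quad\Longleftrightarrow\quad \mathbb{E}[|X_0|^p]<\infty .$$ If this condition is not fulfilled, then $X\notin \ell_{\infty,-1/p}(\mathbb{Z})$ almost surely. Moreover, $$X\in \mathcal{S}'(\mathbb{Z}) \text{ almost surely} \quad\Longleftrightarrow\quad \exists\,\epsilon>0,\ \mathbb{E}[|X_0|^\epsilon]<\infty .$$ If this condition is not fulfilled, then $X\notin \mathcal{S}'(\mathbb{Z})$ almost surely.
   Context: All random variables are defined on a fixed probability space $(\Omega,\mathcal{F},\mathscr{P})$. For $\alpha\in\mathbb{R}$, $\ell_{\infty,\alpha}(\mathbb{Z})$ is the space of real sequences $u=(u[n])_{n\in\mathbb{Z}}$ such that $\|u\|_{\infty,\alpha}=\sup_{n\in\mathbb{Z}}(1+|n|)^{\alpha}|u[n]|<\infty$. The space of tempered sequences is $\mathcal{S}'(\mathbb{Z})=\bigcup_{\alpha\ge 0}\ell_{\infty,-\alpha}(\mathbb{Z})$, i.e. the real sequences bounded in absolute value by a polynomial in $|n|$. *)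

theory Defs
  imports "HOL-Probability.Probability"
begin

text \<open>
  The weighted supremum norm takes values in the extended nonnegative reals, so that an unbounded
  weighted sequence has norm \<open>\<infinity>\<close> rather than an unspecified real supremum.
\<close>

definition weighted_sup_norm :: "real \<Rightarrow> (int \<Rightarrow> real) \<Rightarrow> ennreal" where
  "weighted_sup_norm \<alpha> u = (SUP n. ennreal ((1 + \<bar>real_of_int n\<bar>) powr \<alpha> * \<bar>u n\<bar>))"

definition weighted_l_infinity :: "real \<Rightarrow> (int \<Rightarrow> real) set" where
  "weighted_l_infinity \<alpha> = {u. weighted_sup_norm \<alpha> u < \<infinity>}"

definition tempered_sequences :: "(int \<Rightarrow> real) set" where
  "tempered_sequences = (\<Union>\<alpha>\<in>{0..}. weighted_l_infinity (- \<alpha>))"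

text \<open>
  Measurability of every \<open>X n\<close> is part of the library's \<open>indep_vars\<close>.
\<close>

definition (in prob_space) discrete_white_noise :: "(int \<Rightarrow> 'a \<Rightarrow> real) \<Rightarrow> bool" where
  "discrete_white_noise X \<longleftrightarrow>
     indep_vars (\<lambda>_. borel) X UNIV \<and> (\<forall>m n. distr M borel (X m) = distr M borel (X n))"

end

theory Submission
  imports Defs
begin

text \<open>
  Membership of a sequence \<open>u\<close> in the weighted space with exponent \<open>-1/p\<close> means that
  \<open>\<bar>u n\<bar> powr p\<close> grows at most linearly in \<open>\<bar>n\<bar>\<close>
  (\<open>weighted_l_infinity_iff_linear_growth\<close>), and the integral of a nonnegative variable \<open>Z\<close> is,
  up to an error of at most \<open>1\<close>, the sum over \<open>n\<close> of the probabilities of \<open>Z > 1 + n\<close>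
  (\<open>suminf_tail_emeasure_le\<close> and \<open>nn_integral_le_suminf_tail_emeasure\<close>). With
  \<open>Z = \<bar>X 0\<bar> powr p\<close>, and because all \<open>X n\<close> have the same law, the theorem becomes a statement
  about the events that \<open>\<bar>X n\<bar> powr p\<close> exceeds \<open>1 + \<bar>n\<bar>\<close>.

  If the moment is finite, these events have summable probabilities. By the first Borel-Cantelli
  lemma almost surely only finitely many of them occur, along \<open>n \<ge> 0\<close> and along \<open>n \<le> 0\<close>, so the
  growth is at most linear. If the moment is infinite, then so is that of \<open>Z / C\<close> for every
  \<open>C > 0\<close>, and the events that \<open>\<bar>X n\<bar> powr p\<close> exceeds \<open>C * (1 + n)\<close>, \<open>n \<ge> 0\<close>, have probabilities
  with infinite sum. By independence almost surely at least one of them occurs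
  (\<open>AE_ex_indep_event\<close>). Letting \<open>C\<close> run through the positive integers excludes
  linear growth almost surely.

  The tempered sequences are the increasing union of the weighted spaces with exponent
  \<open>-1/p\<close> for \<open>p = 1/k\<close>, \<open>k = 1, 2, \<dots>\<close>. Countability of this union allows the two
  almost sure statements for fixed \<open>p\<close> to be transferred to it.
\<close>

section \<open>Weighted sequence spaces as growth conditions\<close>

lemma weighted_l_infinity_iff:
  "u \<in> weighted_l_infinity \<alpha> \<longleftrightarrow> (\<exists>K. \<forall>n. (1 + \<bar>real_of_int n\<bar>) powr \<alpha> * \<bar>u n\<bar> \<le> K)"
  (is "_ \<longleftrightarrow> (\<exists>K. \<forall>n. ?w n \<le> K)")
proof
  assume "u \<in> weighted_l_infinity \<alpha>"
  then have fin: "(SUP n. ennreal (?w n)) < \<top>"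
    by (simp add: weighted_l_infinity_def weighted_sup_norm_def)
  have "?w n \<le> enn2real (SUP n. ennreal (?w n))" for n
  proof -
    have "ennreal (?w n) \<le> (SUP n. ennreal (?w n))"
      by (rule SUP_upper) simp
    then show ?thesis
      using enn2real_mono[OF _ fin, of "ennreal (?w n)"] by simp
  qed
  then show "\<exists>K. \<forall>n. ?w n \<le> K" by blast
next
  assume "\<exists>K. \<forall>n. ?w n \<le> K"
  then obtain K where "\<And>n. ?w n \<le> K" by blast
  then have "(SUP n. ennreal (?w n)) \<le> ennreal K"
    by (intro SUP_least ennreal_leI)
  also have "\<dots> < \<infinity>" by simp
  finally show "u \<in> weighted_l_infinity \<alpha>"
    by (simp add: weighted_l_infinity_def weighted_sup_norm_def)
qed

lemma weighted_l_infinity_antimono: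
  assumes "\<beta> \<le> \<alpha>"
  shows "weighted_l_infinity \<alpha> \<subseteq> weighted_l_infinity \<beta>"
proof
  fix u assume "u \<in> weighted_l_infinity \<alpha>"
  then obtain K where K: "\<And>n. (1 + \<bar>real_of_int n\<bar>) powr \<alpha> * \<bar>u n\<bar> \<le> K"
    unfolding weighted_l_infinity_iff by blast
  have "(1 + \<bar>real_of_int n\<bar>) powr \<beta> * \<bar>u n\<bar> \<le> K" for n
  proof -
    have "(1 + \<bar>real_of_int n\<bar>) powr \<beta> \<le> (1 + \<bar>real_of_int n\<bar>) powr \<alpha>"
      using assms by (intro powr_mono) auto
    then show ?thesis
      using K[of n] by (meson abs_ge_zero mult_right_mono order_trans)
  qed
  then show "u \<in> weighted_l_infinity \<beta>"
    unfolding weighted_l_infinity_iff by blast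
qed

text \<open>
  Raising the weighted bound to the power \<open>p\<close> turns the weight into \<open>1 / (1 + \<bar>n\<bar>)\<close>. This is the
  form in which it can be compared with the tail sums of an integral.
\<close>

lemma weighted_l_infinity_iff_linear_growth:
  assumes "p > 0"
  shows "u \<in> weighted_l_infinity (- 1 / p) \<longleftrightarrow>
    (\<exists>C. \<forall>n. \<bar>u n\<bar> powr p \<le> C * (1 + \<bar>real_of_int n\<bar>))"
proof -
  let ?w = "\<lambda>n. (1 + \<bar>real_of_int n\<bar>) powr (- 1 / p) * \<bar>u n\<bar>"
  have w_powr: "?w n powr p = \<bar>u n\<bar> powr p / (1 + \<bar>real_of_int n\<bar>)" for n
    using assms by (simp add: powr_mult powr_divide powr_powr powr_minus_divide)
  have w_nonneg: "?w n \<ge> 0" for n by simp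
  show ?thesis
    unfolding weighted_l_infinity_iff
  proof
    assume "\<exists>K. \<forall>n. ?w n \<le> K"
    then obtain K where K: "\<And>n. ?w n \<le> K" by blast
    have "\<bar>u n\<bar> powr p \<le> K powr p * (1 + \<bar>real_of_int n\<bar>)" for n
      using powr_mono2[OF less_imp_le[OF assms] w_nonneg K, of n]
      unfolding w_powr by (simp add: field_simps)
    then show "\<exists>C. \<forall>n. \<bar>u n\<bar> powr p \<le> C * (1 + \<bar>real_of_int n\<bar>)" by blast
  next
    assume "\<exists>C. \<forall>n. \<bar>u n\<bar> powr p \<le> C * (1 + \<bar>real_of_int n\<bar>)"
    then obtain C where C: "\<And>n. \<bar>u n\<bar> powr p \<le> C * (1 + \<bar>real_of_int n\<bar>)" by blast
    have "?w n \<le> C powr (1 / p)" for n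
    proof -
      have "?w n powr p \<le> C"
        unfolding w_powr using C[of n] by (simp add: field_simps)
      then have "(?w n powr p) powr (1 / p) \<le> C powr (1 / p)"
        using assms by (intro powr_mono2) auto
      then show ?thesis
        using assms w_nonneg[of n] by (simp add: powr_powr)
    qed
    then show "\<exists>K. \<forall>n. ?w n \<le> K" by blast
  qed
qed

text \<open>
  The exponents are written as \<open>-1/p\<close> with \<open>p = 1/(k + 1)\<close>, the form in which the moment
  criterion of order \<open>p\<close> applies to each member of the union.
\<close>

lemma tempered_sequences_eq_countable_union:
  "tempered_sequences = (\<Union>k. weighted_l_infinity (- 1 / (1 / real (Suc k))))"
proof (intro equalityI subsetI)
  fix u assume "u \<in> tempered_sequences"
  then obtain \<alpha> where "u \<in> weighted_l_infinity (- \<alpha>)"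
    unfolding tempered_sequences_def by blast
  moreover obtain k where "\<alpha> \<le> real k" using real_arch_simple by blast
  ultimately have "u \<in> weighted_l_infinity (- 1 / (1 / real (Suc k)))"
    using weighted_l_infinity_antimono[of "- 1 / (1 / real (Suc k))" "- \<alpha>"] by auto
  then show "u \<in> (\<Union>k. weighted_l_infinity (- 1 / (1 / real (Suc k))))" by blast
next
  fix u assume "u \<in> (\<Union>k. weighted_l_infinity (- 1 / (1 / real (Suc k))))"
  then obtain k where "u \<in> weighted_l_infinity (- real (Suc k))" by auto
  then show "u \<in> tempered_sequences"
    unfolding tempered_sequences_def by (intro UN_I[of "real (Suc k)"]) auto
qed

section \<open>Integrals and tail sums\<close>

text \<open>
  The number of \<open>n\<close> with \<open>1 + n < y\<close> is the ceiling of \<open>y - 1\<close>, or \<open>0\<close> if that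
  is negative. For \<open>y \<ge> 0\<close> it lies between \<open>y - 1\<close> and \<open>y\<close>; integrating this count gives the two bounds that follow.
\<close>

lemma suminf_tail_emeasure:
  assumes [measurable]: "Z \<in> borel_measurable M"
  shows "(\<Sum>n. emeasure M {\<omega> \<in> space M. 1 + real n < Z \<omega>}) =
    (\<integral>\<^sup>+ \<omega>. of_nat (nat \<lceil>Z \<omega> - 1\<rceil>) \<partial>M)"
proof -
  have count: "(\<Sum>n. indicator {\<omega> \<in> space M. 1 + real n < Z \<omega>} \<omega>) =
      (of_nat (nat \<lceil>Z \<omega> - 1\<rceil>) :: ennreal)" if "\<omega> \<in> space M" for \<omega>
  proof -
    have iff: "1 + real n < Z \<omega> \<longleftrightarrow> n < nat \<lceil>Z \<omega> - 1\<rceil>" for n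
      by (simp add: zless_nat_eq_int_zless less_ceiling_iff) linarith
    have "(\<Sum>n. indicator {\<omega> \<in> space M. 1 + real n < Z \<omega>} \<omega> :: ennreal) =
        (\<Sum>n<nat \<lceil>Z \<omega> - 1\<rceil>. indicator {\<omega> \<in> space M. 1 + real n < Z \<omega>} \<omega>)"
      by (rule suminf_finite) (auto simp: iff)
    also have "\<dots> = (\<Sum>n<nat \<lceil>Z \<omega> - 1\<rceil>. 1)"
      using that by (intro sum.cong) (auto simp: iff)
    finally show ?thesis by simp
  qed
  have "(\<Sum>n. emeasure M {\<omega> \<in> space M. 1 + real n < Z \<omega>}) =
      (\<Sum>n. \<integral>\<^sup>+ \<omega>. indicator {\<omega> \<in> space M. 1 + real n < Z \<omega>} \<omega> \<partial>M)"
    by (simp add: nn_integral_indicator)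
  also have "\<dots> = (\<integral>\<^sup>+ \<omega>. (\<Sum>n. indicator {\<omega> \<in> space M. 1 + real n < Z \<omega>} \<omega>) \<partial>M)"
    by (rule nn_integral_suminf[symmetric]) measurable
  also have "\<dots> = (\<integral>\<^sup>+ \<omega>. of_nat (nat \<lceil>Z \<omega> - 1\<rceil>) \<partial>M)"
    by (intro nn_integral_cong count)
  finally show ?thesis .
qed

lemma suminf_tail_emeasure_le:
  assumes [measurable]: "Z \<in> borel_measurable M" and nonneg: "\<And>\<omega>. Z \<omega> \<ge> 0"
  shows "(\<Sum>n. emeasure M {\<omega> \<in> space M. 1 + real n < Z \<omega>}) \<le> (\<integral>\<^sup>+ \<omega>. ennreal (Z \<omega>) \<partial>M)"
  unfolding suminf_tail_emeasure[OF assms(1)]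
proof (rule nn_integral_mono)
  fix \<omega>
  have "real (nat \<lceil>Z \<omega> - 1\<rceil>) \<le> Z \<omega>"
    using nonneg[of \<omega>] by linarith
  then show "of_nat (nat \<lceil>Z \<omega> - 1\<rceil>) \<le> ennreal (Z \<omega>)"
    unfolding ennreal_of_nat_eq_real_of_nat by (rule ennreal_leI)
qed

lemma nn_integral_le_suminf_tail_emeasure:
  assumes [measurable]: "Z \<in> borel_measurable M"
  shows "(\<integral>\<^sup>+ \<omega>. ennreal (Z \<omega>) \<partial>M) \<le>
    emeasure M (space M) + (\<Sum>n. emeasure M {\<omega> \<in> space M. 1 + real n < Z \<omega>})"
proof -
  have "(\<integral>\<^sup>+ \<omega>. ennreal (Z \<omega>) \<partial>M) \<le> (\<integral>\<^sup>+ \<omega>. 1 + of_nat (nat \<lceil>Z \<omega> - 1\<rceil>) \<partial>M)"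
  proof (rule nn_integral_mono)
    fix \<omega>
    have "Z \<omega> \<le> real (1 + nat \<lceil>Z \<omega> - 1\<rceil>)" by linarith
    then have "ennreal (Z \<omega>) \<le> of_nat (1 + nat \<lceil>Z \<omega> - 1\<rceil>)"
      unfolding ennreal_of_nat_eq_real_of_nat by (rule ennreal_leI)
    then show "ennreal (Z \<omega>) \<le> 1 + of_nat (nat \<lceil>Z \<omega> - 1\<rceil>)" by simp
  qed
  also have "\<dots> = emeasure M (space M) + (\<integral>\<^sup>+ \<omega>. of_nat (nat \<lceil>Z \<omega> - 1\<rceil>) \<partial>M)"
    by (subst nn_integral_add) auto
  finally show ?thesis
    unfolding suminf_tail_emeasure[OF assms] .
qed

section \<open>Linear growth of sequences of random variables\<close>

context prob_space
begin

text \<open>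
  The first Borel-Cantelli lemma leaves only finitely many indices with \<open>Y n > 1 + n\<close>, and the
  sum of the absolute values up to the last of them is absorbed in the constant \<open>C\<close>.
\<close>

lemma AE_linear_growth:
  fixes Y :: "nat \<Rightarrow> 'a \<Rightarrow> real"
  assumes [measurable]: "\<And>n. Y n \<in> borel_measurable M"
    and summable: "(\<Sum>n. emeasure M {\<omega> \<in> space M. 1 + real n < Y n \<omega>}) < \<infinity>"
  shows "AE \<omega> in M. \<exists>C. \<forall>n. Y n \<omega> \<le> C * (1 + real n)"
proof -
  let ?A = "\<lambda>n. {\<omega> \<in> space M. 1 + real n < Y n \<omega>}"
  have "(\<Sum>n. ennreal (prob (?A n))) \<noteq> \<top>"
    using summable by (simp add: emeasure_eq_measure)
  then have "summable (\<lambda>n. prob (?A n))"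
    by (intro summable_suminf_not_top) auto
  then have "AE \<omega> in M. eventually (\<lambda>n. \<omega> \<in> space M - ?A n) sequentially"
    by (intro borel_cantelli_AE1) (auto simp: less_top[symmetric])
  then show ?thesis
  proof (rule AE_mp, intro AE_I2 impI)
    fix \<omega>
    assume "eventually (\<lambda>n. \<omega> \<in> space M - ?A n) sequentially"
    then obtain N where N: "\<And>n. n \<ge> N \<Longrightarrow> Y n \<omega> \<le> 1 + real n"
      unfolding eventually_sequentially by fastforce
    define C where "C = 1 + (\<Sum>k<N. \<bar>Y k \<omega>\<bar>)"
    have C: "C \<ge> 1" unfolding C_def by (simp add: sum_nonneg)
    have "Y n \<omega> \<le> C * (1 + real n)" for n
    proof (cases "n < N")
      case True
      then have "\<bar>Y n \<omega>\<bar> \<le> (\<Sum>k<N. \<bar>Y k \<omega>\<bar>)"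
        by (intro member_le_sum) auto
      then have "Y n \<omega> \<le> C * 1"
        unfolding C_def using abs_ge_self[of "Y n \<omega>"] by simp
      also have "\<dots> \<le> C * (1 + real n)"
        using C by (intro mult_left_mono) auto
      finally show ?thesis .
    next
      case False
      then have "Y n \<omega> \<le> 1 * (1 + real n)" using N by simp
      also have "\<dots> \<le> C * (1 + real n)"
        using C by (intro mult_right_mono) auto
      finally show ?thesis .
    qed
    then show "\<exists>C. \<forall>n. Y n \<omega> \<le> C * (1 + real n)" by blast
  qed
qed

text \<open>
  The core of the second Borel-Cantelli lemma: by independence and \<open>1 - x \<le> exp (- x)\<close>, the
  probability that none of the events up to \<open>N\<close> occurs is at most \<open>exp (- s N)\<close>, where \<open>s N\<close> is
  the sum of their probabilities, and \<open>s N\<close> tends to infinity.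
\<close>

lemma AE_ex_indep_event:
  fixes f :: "nat \<Rightarrow> 'i"
  assumes indep: "indep_vars S X I" and f: "inj f" "range f \<subseteq> I"
    and B: "\<And>n. B n \<in> sets (S (f n))"
    and div: "(\<Sum>n. emeasure M {\<omega> \<in> space M. X (f n) \<omega> \<in> B n}) = \<infinity>"
  shows "AE \<omega> in M. \<exists>n. X (f n) \<omega> \<in> B n"
proof -
  let ?A = "\<lambda>n. {\<omega> \<in> space M. X (f n) \<omega> \<in> B n}"
  have rv[measurable]: "X (f n) \<in> measurable M (S (f n))" for n
    using indep f(2) by (auto simp: indep_vars_def)
  have A: "?A n \<in> events" for n
    using measurable_sets[OF rv B[of n]] by (simp add: vimage_def Int_def conj_commute)
  define E where "E N = (\<Inter>n\<in>{..N}. space M - ?A n)" for N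
  have E_events: "E N \<in> events" for N
    unfolding E_def using A by (intro sets.finite_INT) auto
  have prob_E: "prob (E N) \<le> exp (- (\<Sum>n\<le>N. prob (?A n)))" for N
  proof -
    (* Independence speaks of sets indexed by the variables, so the complements of the sets B n
       are carried from positions n to indices f n. *)
    define D where "D i = space (S i) - B (inv f i)" for i
    have D: "X (f n) -` D (f n) \<inter> space M = space M - ?A n" for n
      using measurable_space[OF rv[of n]] f(1) by (auto simp: D_def)
    have "prob (E N) = prob (\<Inter>i\<in>f ` {..N}. X i -` D i \<inter> space M)"
      unfolding E_def image_image D ..
    also have "\<dots> = (\<Prod>i\<in>f ` {..N}. prob (X i -` D i \<inter> space M))"
      using f B by (intro indep_varsD[OF indep]) (auto simp: D_def)
    also have "\<dots> = (\<Prod>n\<le>N. prob (X (f n) -` D (f n) \<inter> space M))"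
      using f(1) by (subst prod.reindex) (auto simp: inj_on_def)
    also have "\<dots> = (\<Prod>n\<le>N. 1 - prob (?A n))"
      unfolding D using A by (simp add: prob_compl)
    also have "\<dots> \<le> (\<Prod>n\<le>N. exp (- prob (?A n)))"
    proof (rule prod_mono)
      fix n
      show "0 \<le> 1 - prob (?A n) \<and> 1 - prob (?A n) \<le> exp (- prob (?A n))"
        using exp_ge_add_one_self[of "- prob (?A n)"] by simp
    qed
    also have "\<dots> = exp (- (\<Sum>n\<le>N. prob (?A n)))"
      by (simp add: exp_sum sum_negf[symmetric])
    finally show ?thesis .
  qed
  have not_summable: "\<not> summable (\<lambda>n. prob (?A n))"
  proof
    assume "summable (\<lambda>n. prob (?A n))"
    then have "(\<Sum>n. ennreal (prob (?A n))) \<noteq> \<top>"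
      by (simp add: suminf_ennreal2)
    then show False
      using div by (simp add: emeasure_eq_measure)
  qed
  have small: "\<exists>N. prob (E N) \<le> e" if "e > 0" for e
  proof -
    obtain N where "(\<Sum>n\<le>N. prob (?A n)) > - ln e"
    proof (rule ccontr)
      assume "\<not> thesis"
      then have "(\<Sum>n\<le>N. prob (?A n)) \<le> - ln e" for N
        using that by (meson not_le)
      then have "summable (\<lambda>n. prob (?A n))"
        by (intro bounded_imp_summable) auto
      with not_summable show False by simp
    qed
    then have "exp (- (\<Sum>n\<le>N. prob (?A n))) \<le> exp (ln e)" by simp
    with prob_E[of N] that show ?thesis by (intro exI[of _ N]) simp
  qed
  let ?F = "\<Inter>N. E N"
  have F_events: "?F \<in> events"
    using E_events by (intro sets.countable_INT) auto
  have "prob ?F \<le> e" if e: "e > 0" for e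
  proof -
    obtain N where N: "prob (E N) \<le> e" using small[OF e] by blast
    have "prob ?F \<le> prob (E N)"
      using E_events by (intro finite_measure_mono) auto
    with N show ?thesis by simp
  qed
  then have "prob ?F \<le> 0" by (rule field_le_epsilon[of _ 0, simplified])
  then have "prob ?F = 0" by (simp add: measure_le_0_iff)
  then have "?F \<in> null_sets M"
    using F_events by (simp add: null_setsI emeasure_eq_measure)
  then show ?thesis
    by (rule AE_I') (auto simp: E_def)
qed

section \<open>White noise\<close>

lemma white_noise_measurable:
  assumes "discrete_white_noise X"
  shows "X n \<in> borel_measurable M"
  using assms by (auto simp: discrete_white_noise_def indep_vars_def)

lemma white_noise_emeasure_eq:
  assumes X: "discrete_white_noise X" and B: "B \<in> sets borel"
  shows "emeasure M {\<omega> \<in> space M. X m \<omega> \<in> B} = emeasure M {\<omega> \<in> space M. X n \<omega> \<in> B}"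
proof -
  have *: "emeasure M {\<omega> \<in> space M. X k \<omega> \<in> B} = emeasure (distr M borel (X k)) B" for k
    using white_noise_measurable[OF X] B
    by (simp add: emeasure_distr vimage_def Int_def conj_commute)
  have "distr M borel (X m) = distr M borel (X n)"
    using X by (simp add: discrete_white_noise_def)
  then show ?thesis by (simp add: *)
qed

lemma white_noise_AE_in_weighted_l_infinity:
  assumes X: "discrete_white_noise X" and p: "p > 0"
    and moment: "(\<integral>\<^sup>+ \<omega>. ennreal (\<bar>X 0 \<omega>\<bar> powr p) \<partial>M) < \<infinity>"
  shows "AE \<omega> in M. (\<lambda>n. X n \<omega>) \<in> weighted_l_infinity (- 1 / p)"
proof -
  note [measurable] = white_noise_measurable[OF X]
  have growth: "AE \<omega> in M. \<exists>C. \<forall>n. \<bar>X (f n) \<omega>\<bar> powr p \<le> C * (1 + real n)" for f :: "nat \<Rightarrow> int"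
  proof (rule AE_linear_growth)
    have "emeasure M {\<omega> \<in> space M. 1 + real n < \<bar>X (f n) \<omega>\<bar> powr p} =
        emeasure M {\<omega> \<in> space M. 1 + real n < \<bar>X 0 \<omega>\<bar> powr p}" for n
      using white_noise_emeasure_eq[OF X, of "{x. 1 + real n < \<bar>x\<bar> powr p}" "f n" 0] by simp
    then have "(\<Sum>n. emeasure M {\<omega> \<in> space M. 1 + real n < \<bar>X (f n) \<omega>\<bar> powr p}) \<le>
        (\<integral>\<^sup>+ \<omega>. ennreal (\<bar>X 0 \<omega>\<bar> powr p) \<partial>M)"
      by (simp add: suminf_tail_emeasure_le)
    also note moment
    finally show "(\<Sum>n. emeasure M {\<omega> \<in> space M. 1 + real n < \<bar>X (f n) \<omega>\<bar> powr p}) < \<infinity>" .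
  qed measurable
  show ?thesis
    using growth[of int] growth[of "\<lambda>n. - int n"]
  proof eventually_elim
    case (elim \<omega>)
    then obtain C D where C: "\<And>n. \<bar>X (int n) \<omega>\<bar> powr p \<le> C * (1 + real n)"
      and D: "\<And>n. \<bar>X (- int n) \<omega>\<bar> powr p \<le> D * (1 + real n)"
      by blast
    have "\<bar>X n \<omega>\<bar> powr p \<le> max C D * (1 + \<bar>real_of_int n\<bar>)" for n
    proof (cases n rule: int_cases2)
      case (nonneg k)
      have "C * (1 + real k) \<le> max C D * (1 + real k)"
        by (intro mult_right_mono) auto
      with order_trans[OF C[of k]] nonneg show ?thesis by simp
    next
      case (nonpos k)
      have "D * (1 + real k) \<le> max C D * (1 + real k)"
        by (intro mult_right_mono) auto
      with order_trans[OF D[of k]] nonpos show ?thesis by simp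
    qed
    then show ?case
      unfolding weighted_l_infinity_iff_linear_growth[OF p] by blast
  qed
qed

lemma white_noise_AE_notin_weighted_l_infinity:
  assumes X: "discrete_white_noise X" and p: "p > 0"
    and moment: "(\<integral>\<^sup>+ \<omega>. ennreal (\<bar>X 0 \<omega>\<bar> powr p) \<partial>M) = \<infinity>"
  shows "AE \<omega> in M. (\<lambda>n. X n \<omega>) \<notin> weighted_l_infinity (- 1 / p)"
proof -
  note [measurable] = white_noise_measurable[OF X]
  have exceed: "AE \<omega> in M. \<exists>n. X (int n) \<omega> \<in> {x. 1 + real n < \<bar>x\<bar> powr p / real (Suc c)}" for c
  proof (rule AE_ex_indep_event)
    show "indep_vars (\<lambda>_. borel) X UNIV"
      using X by (simp add: discrete_white_noise_def)
    have "ennreal (real (Suc c)) * (\<integral>\<^sup>+ \<omega>. ennreal (\<bar>X 0 \<omega>\<bar> powr p / real (Suc c)) \<partial>M) =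
        (\<integral>\<^sup>+ \<omega>. ennreal (real (Suc c)) * ennreal (\<bar>X 0 \<omega>\<bar> powr p / real (Suc c)) \<partial>M)"
      by (rule nn_integral_cmult[symmetric]) measurable
    also have "\<dots> = (\<integral>\<^sup>+ \<omega>. ennreal (\<bar>X 0 \<omega>\<bar> powr p) \<partial>M)"
      by (intro nn_integral_cong) (simp add: ennreal_mult[symmetric] del: of_nat_Suc)
    finally have "(\<integral>\<^sup>+ \<omega>. ennreal (\<bar>X 0 \<omega>\<bar> powr p / real (Suc c)) \<partial>M) = \<infinity>"
      using moment by (auto simp: ennreal_mult_eq_top_iff)
    then have "(\<Sum>n. emeasure M {\<omega> \<in> space M. 1 + real n < \<bar>X 0 \<omega>\<bar> powr p / real (Suc c)}) = \<infinity>"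
      using nn_integral_le_suminf_tail_emeasure[of "\<lambda>\<omega>. \<bar>X 0 \<omega>\<bar> powr p / real (Suc c)" M]
      by (simp add: emeasure_space_1 top_unique ennreal_add_eq_top del: of_nat_Suc)
    moreover have "emeasure M {\<omega> \<in> space M. X (int n) \<omega> \<in> {x. 1 + real n < \<bar>x\<bar> powr p / real (Suc c)}} =
        emeasure M {\<omega> \<in> space M. 1 + real n < \<bar>X 0 \<omega>\<bar> powr p / real (Suc c)}" for n
      using white_noise_emeasure_eq[OF X, of "{x. 1 + real n < \<bar>x\<bar> powr p / real (Suc c)}" "int n" 0]
      by simp
    ultimately show "(\<Sum>n. emeasure M {\<omega> \<in> space M.
        X (int n) \<omega> \<in> {x. 1 + real n < \<bar>x\<bar> powr p / real (Suc c)}}) = \<infinity>"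
      by simp
  qed auto
  have "AE \<omega> in M. \<forall>c. \<exists>n. X (int n) \<omega> \<in> {x. 1 + real n < \<bar>x\<bar> powr p / real (Suc c)}"
    unfolding AE_all_countable using exceed by blast
  then show ?thesis
  proof eventually_elim
    case (elim \<omega>)
    show ?case
    proof
      assume "(\<lambda>n. X n \<omega>) \<in> weighted_l_infinity (- 1 / p)"
      then obtain C where C: "\<And>n. \<bar>X n \<omega>\<bar> powr p \<le> C * (1 + \<bar>real_of_int n\<bar>)"
        unfolding weighted_l_infinity_iff_linear_growth[OF p] by blast
      obtain c where c: "C \<le> real c" using real_arch_simple by blast
      obtain n where "1 + real n < \<bar>X (int n) \<omega>\<bar> powr p / real (Suc c)"
        using elim by blast
      then have "real (Suc c) * (1 + real n) < \<bar>X (int n) \<omega>\<bar> powr p"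
        by (simp add: field_simps)
      also have "\<dots> \<le> C * (1 + real n)" using C[of "int n"] by simp
      also have "\<dots> \<le> real (Suc c) * (1 + real n)"
        using c by (intro mult_right_mono) auto
      finally show False by simp
    qed
  qed
qed

lemma white_noise_AE_in_tempered_sequences:
  assumes X: "discrete_white_noise X" and \<epsilon>: "\<epsilon> > 0"
    and moment: "(\<integral>\<^sup>+ \<omega>. ennreal (\<bar>X 0 \<omega>\<bar> powr \<epsilon>) \<partial>M) < \<infinity>"
  shows "AE \<omega> in M. (\<lambda>n. X n \<omega>) \<in> tempered_sequences"
  using white_noise_AE_in_weighted_l_infinity[OF assms]
proof eventually_elim
  case (elim \<omega>)
  then show ?case
    using \<epsilon> unfolding tempered_sequences_def by (intro UN_I[of "1 / \<epsilon>"]) auto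
qed

lemma white_noise_AE_notin_tempered_sequences:
  assumes X: "discrete_white_noise X"
    and moment: "\<And>\<epsilon>. \<epsilon> > 0 \<Longrightarrow> (\<integral>\<^sup>+ \<omega>. ennreal (\<bar>X 0 \<omega>\<bar> powr \<epsilon>) \<partial>M) = \<infinity>"
  shows "AE \<omega> in M. (\<lambda>n. X n \<omega>) \<notin> tempered_sequences"
proof -
  have "AE \<omega> in M. (\<lambda>n. X n \<omega>) \<notin> weighted_l_infinity (- 1 / (1 / real (Suc k)))" for k
    by (intro white_noise_AE_notin_weighted_l_infinity X moment) auto
  then have "AE \<omega> in M. \<forall>k. (\<lambda>n. X n \<omega>) \<notin> weighted_l_infinity (- 1 / (1 / real (Suc k)))"
    unfolding AE_all_countable by blast
  then show ?thesis
    unfolding tempered_sequences_eq_countable_union by eventually_elim blast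
qed

lemma AE_contradiction:
  assumes "AE \<omega> in M. P \<omega>" "AE \<omega> in M. \<not> P \<omega>"
  shows False
proof -
  have "AE \<omega> in M. False"
    using assms by eventually_elim simp
  then show False by simp
qed

end

theorem theorem2:
  fixes M :: "'a measure" and X :: "int \<Rightarrow> 'a \<Rightarrow> real" and p :: real
  assumes "prob_space M"
    and "prob_space.discrete_white_noise M X"
    and "p > 0"
  shows "((AE \<omega> in M. (\<lambda>n. X n \<omega>) \<in> weighted_l_infinity (- 1 / p)) \<longleftrightarrow>
            (\<integral>\<^sup>+ \<omega>. ennreal (\<bar>X 0 \<omega>\<bar> powr p) \<partial>M) < \<infinity>)
       \<and> (\<not> (\<integral>\<^sup>+ \<omega>. ennreal (\<bar>X 0 \<omega>\<bar> powr p) \<partial>M) < \<infinity> \<longrightarrow>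
            (AE \<omega> in M. (\<lambda>n. X n \<omega>) \<notin> weighted_l_infinity (- 1 / p)))
       \<and> ((AE \<omega> in M. (\<lambda>n. X n \<omega>) \<in> tempered_sequences) \<longleftrightarrow>
            (\<exists>\<epsilon>>0. (\<integral>\<^sup>+ \<omega>. ennreal (\<bar>X 0 \<omega>\<bar> powr \<epsilon>) \<partial>M) < \<infinity>))
       \<and> (\<not> (\<exists>\<epsilon>>0. (\<integral>\<^sup>+ \<omega>. ennreal (\<bar>X 0 \<omega>\<bar> powr \<epsilon>) \<partial>M) < \<infinity>) \<longrightarrow>
            (AE \<omega> in M. (\<lambda>n. X n \<omega>) \<notin> tempered_sequences))"
proof -
  interpret prob_space M by fact
  let ?m = "\<lambda>p. \<integral>\<^sup>+ \<omega>. ennreal (\<bar>X 0 \<omega>\<bar> powr p) \<partial>M"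
  let ?L = "weighted_l_infinity (- 1 / p)"
  have L_in: "AE \<omega> in M. (\<lambda>n. X n \<omega>) \<in> ?L" if "?m p < \<infinity>"
    using white_noise_AE_in_weighted_l_infinity[OF assms(2,3) that] .
  have L_notin: "AE \<omega> in M. (\<lambda>n. X n \<omega>) \<notin> ?L" if "\<not> ?m p < \<infinity>"
    using that
    by (intro white_noise_AE_notin_weighted_l_infinity[OF assms(2,3)]) (simp add: less_top[symmetric])
  have S_in: "AE \<omega> in M. (\<lambda>n. X n \<omega>) \<in> tempered_sequences" if "\<exists>\<epsilon>>0. ?m \<epsilon> < \<infinity>"
    using white_noise_AE_in_tempered_sequences[OF assms(2)] that by blast
  have S_notin: "AE \<omega> in M. (\<lambda>n. X n \<omega>) \<notin> tempered_sequences" if "\<not> (\<exists>\<epsilon>>0. ?m \<epsilon> < \<infinity>)"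
    using white_noise_AE_notin_tempered_sequences[OF assms(2)] that
    by (metis infinity_ennreal_def less_top)
  have "(AE \<omega> in M. (\<lambda>n. X n \<omega>) \<in> ?L) \<longleftrightarrow> ?m p < \<infinity>"
    using L_in L_notin AE_contradiction by blast
  moreover have "(AE \<omega> in M. (\<lambda>n. X n \<omega>) \<in> tempered_sequences) \<longleftrightarrow> (\<exists>\<epsilon>>0. ?m \<epsilon> < \<infinity>)"
    using S_in S_notin AE_contradiction by blast
  ultimately show ?thesis
    using L_notin S_notin by blast
qed

end
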